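(* Let $N$ and $\rho$ be integers with $0<\rho<N$, and let $q=(q')^{\rho+1}$ for a prime power $q'$. Define $k:=\left\lceil\frac{N-\rho}{\rho+1}\right\rceil$, $\ell:=N+1-k(\rho+1)=(N\bmod(\rho+1))+1$, \[ \tilde a(\rho,j):=\frac{\rho(\rho+2j+1)-j(3j+1)}{2},\qquad \bar a(N,\rho,j):=\frac{\ell(2\rho-\ell+2j+1)-j(3j+1)}{2}, \] \[ \tilde c(N,\rho):=(k-1)\frac{\rho^2(\rho+1)}{2},\qquad \bar c(N,\rho):=\frac{\rho(\rho+1)+\ell(\ell-1)(2\rho-\ell+1)}{2}, \] and $\delta_{q'=2}:=1$ if $q'=2$ and $0$ otherwise. Then \begin{align*} s_q(N,\rho)\le{}&\sum_{i=1}^{k}\frac{(\rho+1)(\rho+2)}{2}(q')^{N+1-i(\rho+1)}+\sum_{i=1}^{k-1}\sum_{j=1}^{\rho-1}\tilde a(\rho,j)(q')^{N+1-i(\rho+1)-j}\\ &+\sum_{j=1}^{\ell-1}\bar a(N,\rho,j)(q')^{\ell-j}-\tilde c(N,\rho)-\bar c(N,\rho)\\ &+\delta_{q'=2}\left((2^{\rho-1}-1)\sum_{i=1}^{k-1}2^{N-\rho+2-i(\rho+1)}+2^{\ell}-2\right). \end{align*}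
   Context: A point $P$ of $\mathrm{PG}(N,q)$ is $\rho$-saturated by a point set $\mathcal{S}$ if there exists a subspace through $P$ of dimension at most $\rho$ spanned by points of $\mathcal{S}$. A point set $\mathcal{S}$ is a $\rho$-saturating set of $\mathrm{PG}(N,q)$ if $\rho$ is the least integer such that all points of $\mathrm{PG}(N,q)$ are $\rho$-saturated by $\mathcal{S}$. $s_q(N,\rho)$ denotes the minimum size of a $\rho$-saturating set of $\mathrm{PG}(N,q)$. *)

theory Defs
  imports "HOL-Analysis.Cartesian_Space" "HOL-Number_Theory.Prime_Powers"
begin

text \<open>The space \<open>PG(N,q)\<close> is modelled by the lattice of subspaces of \<open>'a ^ 'n\<close>, where
  \<open>CARD('a) = q\<close> and \<open>CARD('n) = N + 1\<close>.\<close>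

definition pg_points :: "('a::field ^ 'n) set set" where
  "pg_points = {P. vec.subspace P \<and> vec.dim P = 1}"

definition pg_span :: "('a::field ^ 'n) set set \<Rightarrow> ('a ^ 'n) set" where
  "pg_span T = vec.span (\<Union>T)"

definition pg_dim :: "('a::field ^ 'n) set \<Rightarrow> int" where
  "pg_dim U = int (vec.dim U) - 1"

definition saturated_by :: "nat \<Rightarrow> ('a::field ^ 'n) set set \<Rightarrow> ('a ^ 'n) set \<Rightarrow> bool" where
  "saturated_by \<rho> S P \<longleftrightarrow> (\<exists>T\<subseteq>S. P \<subseteq> pg_span T \<and> pg_dim (pg_span T) \<le> int \<rho>)"

text \<open>Letting \<open>\<sigma>\<close> range over \<open>nat\<close> rather than \<open>int\<close> is no restriction, since a subspace
  through a point has projective dimension at least \<open>0\<close>.\<close>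

definition saturating_set :: "nat \<Rightarrow> ('a::field ^ 'n) set set \<Rightarrow> bool" where
  "saturating_set \<rho> S \<longleftrightarrow> S \<subseteq> pg_points \<and>
     (\<forall>P\<in>pg_points. saturated_by \<rho> S P) \<and>
     (\<forall>\<sigma>. (\<forall>P\<in>pg_points. saturated_by \<sigma> S P) \<longrightarrow> \<rho> \<le> \<sigma>)"

text \<open>\<open>min_saturating_size TYPE('a) TYPE('n) \<rho>\<close> is \<open>s_q(N,\<rho>)\<close> for \<open>q = CARD('a)\<close> and
  \<open>N = CARD('n) - 1\<close>.\<close>

definition min_saturating_size ::
    "'a::{field,finite} itself \<Rightarrow> 'n::finite itself \<Rightarrow> nat \<Rightarrow> nat" where
  "min_saturating_size _ _ \<rho> =
     (LEAST m. \<exists>S :: ('a ^ 'n) set set. saturating_set \<rho> S \<and> card S = m)"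

definition sat_k :: "nat \<Rightarrow> nat \<Rightarrow> nat" where
  "sat_k N \<rho> = nat \<lceil>(real N - real \<rho>) / (real \<rho> + 1)\<rceil>"

definition sat_l :: "nat \<Rightarrow> nat \<Rightarrow> nat" where
  "sat_l N \<rho> = N + 1 - sat_k N \<rho> * (\<rho> + 1)"

definition a_tilde :: "nat \<Rightarrow> nat \<Rightarrow> real" where
  "a_tilde \<rho> j =
     (real \<rho> * (real \<rho> + 2 * real j + 1) - real j * (3 * real j + 1)) / 2"

definition a_bar :: "nat \<Rightarrow> nat \<Rightarrow> nat \<Rightarrow> real" where
  "a_bar N \<rho> j =
     (let l = real (sat_l N \<rho>)
      in (l * (2 * real \<rho> - l + 2 * real j + 1) - real j * (3 * real j + 1)) / 2)"

definition c_tilde :: "nat \<Rightarrow> nat \<Rightarrow> real" where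
  "c_tilde N \<rho> = (real (sat_k N \<rho>) - 1) * ((real \<rho>)\<^sup>2 * (real \<rho> + 1) / 2)"

definition c_bar :: "nat \<Rightarrow> nat \<Rightarrow> real" where
  "c_bar N \<rho> =
     (let l = real (sat_l N \<rho>)
      in (real \<rho> * (real \<rho> + 1) + l * (l - 1) * (2 * real \<rho> - l + 1)) / 2)"

text \<open>By \<open>sat_k_mult_le\<close>, the natural-number subtraction in \<open>sat_l\<close> does not truncate, nor do
  those in exponents such as \<open>N + 1 - i (\<rho> + 1)\<close> for \<open>i \<le> sat_k N \<rho>\<close>.\<close>

lemma sat_k_eq_div:
  assumes "\<rho> < N"
  shows "sat_k N \<rho> = N div (\<rho> + 1)"
proof -
  define m r where "m = N div (\<rho> + 1)" and "r = N mod (\<rho> + 1)"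
  have N: "N = m * (\<rho> + 1) + r" and r: "r < \<rho> + 1"
    unfolding m_def r_def by (simp_all only: div_mult_mod_eq mod_less_divisor add_gr_0 zero_less_one disj_comms simp_thms)
  have "\<lceil>(real N - real \<rho>) / (real \<rho> + 1)\<rceil> = int m"
  proof (rule ceiling_unique)
    show "real_of_int (int m) - 1 < (real N - real \<rho>) / (real \<rho> + 1)"
      using N by (simp add: field_simps)
    have "real N \<le> real m * (real \<rho> + 1) + real \<rho>"
      using N r by (simp add: algebra_simps)
    then show "(real N - real \<rho>) / (real \<rho> + 1) \<le> real_of_int (int m)"
      by (simp add: field_simps)
  qed
  then show ?thesis
    by (simp add: sat_k_def m_def)
qed

lemma sat_k_mult_le:
  assumes "\<rho> < N"
  shows "sat_k N \<rho> * (\<rho> + 1) \<le> N"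
  using assms by (simp only: sat_k_eq_div div_times_less_eq_dividend)

lemma sat_l_eq_mod:
  assumes "\<rho> < N"
  shows "sat_l N \<rho> = N mod (\<rho> + 1) + 1"
  using sat_k_mult_le[OF assms] div_mult_mod_eq[of N "\<rho> + 1"]
  unfolding sat_l_def sat_k_eq_div[OF assms] by linarith

end

theory Submission
  imports Defs "HOL-Computational_Algebra.Polynomial" "HOL-Library.FuncSet"
begin

text \<open>Put \<open>r = \<rho> + 1\<close> and \<open>Q = q'\<close>, let \<open>F\<close> be the subfield of order \<open>Q\<close> of the field \<open>K\<close> of
  order \<open>Q ^ r\<close>, and let \<open>\<gamma> 0, \<dots>, \<gamma> \<rho>\<close> be an \<open>F\<close>-basis of \<open>K\<close>. Cut the coordinates into
  consecutive blocks of length \<open>r\<close>. The points for a block are \<open>e\<^sub>i + \<gamma> k a\<close>, where \<open>e\<^sub>i\<close> is the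
  \<open>i\<close>-th unit vector of the block, \<open>k \<le> i\<close>, and \<open>a\<close> runs over the vectors with entries in \<open>F\<close>
  supported behind the block. As the choice \<open>a = 0\<close> does not depend on \<open>k\<close>, a block with \<open>n\<close>
  coordinates behind it costs \<open>r + r (r + 1) / 2 * (Q ^ n - 1)\<close> points, which the bound allows.

  Let \<open>x\<close> be a vector whose first nonzero coordinate lies in the block. One chooses greedily
  indices \<open>\<kappa> i \<le> i\<close> such that the \<open>c i = x i * \<gamma> (\<kappa> i)\<close> (with \<open>x i\<close> replaced by \<open>1\<close> if it vanishes)
  are independent over \<open>F\<close>, hence an \<open>F\<close>-basis of \<open>K\<close>. Expanding the coordinates of \<open>x\<close> behind the
  block in this basis exhibits \<open>x\<close> as a combination of \<open>r\<close> of the points. Behind the last block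
  there remain \<open>l \<le> r\<close> coordinates; if \<open>l < r\<close>, their unit vectors are spanned by differences of
  points of that block, and if \<open>l = r\<close>, these unit vectors are added to the set, which the
  lower-order terms of the bound pay for.

  This gives a set all of whose points are \<open>\<rho>\<close>-saturated, but \<open>\<rho>\<close> need not be the least such
  number. An exact \<open>\<rho>\<close>-saturating set of at most the same size is found by deforming the set
  into a basis in steps that raise the least such number by at most one.\<close>

section \<open>Subfields of finite fields\<close>

text \<open>Multiplication by a nonzero \<open>x\<close> permutes the nonzero elements and so
  preserves their product, which can then be cancelled.\<close>

lemma finite_field_power_card:
  fixes x :: "'a::{field,finite}"
  shows "x ^ CARD('a) = x"
proof (cases "x = 0")
  case False
  have "(\<Prod>y\<in>UNIV-{0}. x * y) = (\<Prod>y\<in>UNIV-{0}. y)"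
    by (rule prod.reindex_bij_witness[of _ "\<lambda>y. y / x" "\<lambda>y. x * y"]) (use False in auto)
  then have "x ^ (CARD('a) - 1) = 1"
    by (simp add: prod.distrib)
  then show ?thesis
    using power_Suc[of x "CARD('a) - 1"] by (simp add: Suc_diff_1)
qed simp

text \<open>Translation by 1 permutes the field; comparing the sums of all elements shows that the
  characteristic divides \<open>p ^ m\<close>.\<close>

lemma finite_field_CHAR_eq:
  assumes "prime p" and "CARD('a::{field,finite}) = p ^ m"
  shows "CHAR('a) = p"
proof -
  have prime: "prime CHAR('a)"
    by (rule prime_CHAR_semidom) (simp add: finite_imp_CHAR_pos)
  have "(\<Sum>x\<in>UNIV. x + 1) = (\<Sum>x\<in>UNIV. x :: 'a)"
    by (rule sum.reindex_bij_witness[of _ "\<lambda>y. y - 1" "\<lambda>y. y + 1"]) auto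
  then have "of_nat CARD('a) = (0 :: 'a)"
    by (simp add: sum.distrib)
  then have "CHAR('a) dvd p ^ m"
    unfolding assms(2)[symmetric] by (simp only: of_nat_eq_0_iff_char_dvd)
  then show ?thesis
    using prime assms(1) by (metis prime_dvd_power primes_dvd_imp_eq)
qed

locale subfield_set =
  fixes F :: "'a::{field,finite} set"
  assumes zero_mem: "0 \<in> F" and one_mem: "1 \<in> F"
    and add_mem: "\<lbrakk>x \<in> F; y \<in> F\<rbrakk> \<Longrightarrow> x + y \<in> F"
    and diff_mem: "\<lbrakk>x \<in> F; y \<in> F\<rbrakk> \<Longrightarrow> x - y \<in> F"
    and mult_mem: "\<lbrakk>x \<in> F; y \<in> F\<rbrakk> \<Longrightarrow> x * y \<in> F"
    and inverse_mem: "x \<in> F \<Longrightarrow> inverse x \<in> F"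

text \<open>In characteristic \<open>p\<close>, taking \<open>p ^ e\<close>-th powers is a field
  homomorphism, and its fixed points form a subfield.\<close>

lemma subfield_set_fixed_points:
  assumes "prime p" and "CARD('a::{field,finite}) = p ^ m"
  shows "subfield_set {x :: 'a. x ^ (p ^ e) = x}"
proof -
  have char: "CHAR('a) = p"
    using assms by (rule finite_field_CHAR_eq)
  have add: "(x + y) ^ (p ^ e) = x ^ (p ^ e) + y ^ (p ^ e)" for x y :: 'a
    by (rule freshmans_dream') (use char assms in auto)
  have diff: "(x - y) ^ (p ^ e) = x ^ (p ^ e) - y ^ (p ^ e)" for x y :: 'a
    using add[of "x - y" y] by simp
  have "p ^ e > 0"
    using assms(1) by (simp add: prime_gt_0_nat)
  then show ?thesis
    by unfold_locales (auto simp: add diff power_mult_distrib power_inverse zero_power)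
qed

lemma card_fixed_points_le:
  assumes "1 < Q"
  shows "card {x :: 'a::field. x ^ Q = x} \<le> Q"
proof -
  define P :: "'a poly" where "P = monom 1 Q + [:0, -1:]"
  have "degree P = Q"
    unfolding P_def using assms by (subst degree_add_eq_left) (auto simp: degree_monom_eq)
  moreover from this assms have "P \<noteq> 0"
    by auto
  moreover have "poly P x = x ^ Q - x" for x
    by (simp add: P_def poly_monom)
  ultimately show ?thesis
    using card_poly_roots_bound[of P] by simp
qed

text \<open>The polynomial \<open>X ^ (q - 1) - 1\<close> has \<open>q - 1\<close> roots and is divisible by
  \<open>X ^ (Q - 1) - 1\<close>; the cofactor has degree \<open>q - Q\<close>, hence at most \<open>q - Q\<close> roots.\<close>

lemma card_fixed_points:
  assumes Q: "1 < Q" and card: "CARD('a::{field,finite}) = Q ^ r" and r: "0 < r"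
  shows "card {x :: 'a. x ^ Q = x} = Q"
proof (rule antisym[OF card_fixed_points_le[OF Q]])
  define q where "q = CARD('a)"
  have "Q \<le> q"
    using Q r by (simp add: q_def card self_le_power)
  have "Q - 1 dvd q - 1"
  proof -
    have "int Q - 1 dvd int Q ^ r - 1 ^ r"
      using dvd_power_same by (metis power_diff_sumr2 dvd_triv_left power_one)
    then have "int (Q - 1) dvd int (q - 1)"
      using Q \<open>Q \<le> q\<close> by (simp add: q_def card of_nat_diff)
    then show ?thesis
      by simp
  qed
  then obtain s where s: "q - 1 = (Q - 1) * s" ..
  have "s > 0"
    using s Q \<open>Q \<le> q\<close> by (cases s) auto
  define g :: "'a poly" where "g = (\<Sum>i<s. monom 1 ((Q - 1) * i))"
  have g: "poly g x = (\<Sum>i<s. (x ^ (Q - 1)) ^ i)" for x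
    by (simp add: g_def poly_sum poly_monom power_mult)
  have "degree g \<le> (Q - 1) * (s - 1)"
    unfolding g_def by (rule degree_sum_le) (auto intro!: order.trans[OF degree_monom_le])
  moreover have "(Q - 1) * (s - 1) = q - Q"
    using s Q by (simp add: algebra_simps)
  moreover have "g \<noteq> 0"
  proof
    assume "g = 0"
    then have "poly g 0 = 0"
      by simp
    moreover have "poly g 0 = 1"
      using \<open>s > 0\<close> Q by (simp add: g power_0_left sum.delta')
    ultimately show False
      by simp
  qed
  ultimately have roots: "card {x. poly g x = 0} \<le> q - Q"
    using card_poly_roots_bound[of g] by simp
  have "x ^ Q = x \<or> poly g x = 0" for x :: 'a
  proof (cases "x = 0")
    case False
    have "x * x ^ (q - 1) = x"
      using finite_field_power_card[of x] power_Suc[of x "q - 1"] Q \<open>Q \<le> q\<close>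
      by (simp add: q_def)
    then have "x ^ (q - 1) = 1"
      using False by simp
    then have "(x ^ (Q - 1)) ^ s = 1"
      unfolding s power_mult .
    then have "(x ^ (Q - 1) - 1) * poly g x = 0"
      unfolding g using power_diff_1_eq[of "x ^ (Q - 1)" s] by simp
    moreover have "x ^ Q = x" if "x ^ (Q - 1) = 1"
      using that power_Suc[of x "Q - 1"] Q by simp
    ultimately show ?thesis
      by auto
  qed (use Q in auto)
  then have "UNIV = {x :: 'a. x ^ Q = x} \<union> {x. poly g x = 0}"
    by blast
  then have "q \<le> card {x :: 'a. x ^ Q = x} + card {x. poly g x = 0}"
    unfolding q_def by (metis card_Un_le)
  with roots \<open>Q \<le> q\<close> show "Q \<le> card {x :: 'a. x ^ Q = x}"
    by linarith
qed

section \<open>Spans and independence over the subfield\<close>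

context subfield_set
begin

text \<open>Spans over the set \<open>F\<close> are built one generator at a time, so that counting
  them is an induction; \<open>lin_indep\<close> tests each element against its predecessors only,
  which is what a greedy choice supplies.\<close>

primrec lincombs :: "(nat \<Rightarrow> 'a) \<Rightarrow> nat \<Rightarrow> 'a set" where
  "lincombs c 0 = {0}"
| "lincombs c (Suc m) = (\<lambda>(s, a). s + a * c m) ` (lincombs c m \<times> F)"

definition lin_indep :: "(nat \<Rightarrow> 'a) \<Rightarrow> nat \<Rightarrow> bool" where
  "lin_indep c m \<longleftrightarrow> (\<forall>i<m. c i \<notin> lincombs c i)"

lemma lincombs_cong: "(\<And>i. i < m \<Longrightarrow> c i = d i) \<Longrightarrow> lincombs c m = lincombs d m"
  by (induction m) auto

lemma lincombs_SucI: "\<lbrakk>s \<in> lincombs c m; a \<in> F; x = s + a * c m\<rbrakk> \<Longrightarrow> x \<in> lincombs c (Suc m)"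
  by auto

lemma lincombs_zero: "0 \<in> lincombs c m"
  using zero_mem by (induction m) (auto intro: lincombs_SucI simp del: lincombs.simps(2))

lemma lincombs_add: "\<lbrakk>x \<in> lincombs c m; y \<in> lincombs c m\<rbrakk> \<Longrightarrow> x + y \<in> lincombs c m"
proof (induction m arbitrary: x y)
  case (Suc m)
  then obtain s a t b where "x = s + a * c m" "s \<in> lincombs c m" "a \<in> F"
    "y = t + b * c m" "t \<in> lincombs c m" "b \<in> F"
    by auto
  then show ?case
    using Suc.IH[of s t] add_mem[of a b]
    by (intro lincombs_SucI[of "s + t" _ _ "a + b"]) (auto simp: algebra_simps)
qed simp

lemma lincombs_scale: "\<lbrakk>x \<in> lincombs c m; b \<in> F\<rbrakk> \<Longrightarrow> b * x \<in> lincombs c m"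
proof (induction m arbitrary: x)
  case (Suc m)
  then obtain s a where "x = s + a * c m" "s \<in> lincombs c m" "a \<in> F"
    by auto
  then show ?case
    using Suc.IH[of s] Suc.prems mult_mem[of b a]
    by (intro lincombs_SucI[of "b * s" _ _ "b * a"]) (auto simp: algebra_simps)
qed simp

lemma lincombs_diff: "\<lbrakk>x \<in> lincombs c m; y \<in> lincombs c m\<rbrakk> \<Longrightarrow> x - y \<in> lincombs c m"
  using lincombs_add[of x c m "- 1 * y"] lincombs_scale[of y c m "- 1"]
    diff_mem[OF zero_mem one_mem] by simp

lemma lincombs_imp_sum:
  "x \<in> lincombs c m \<Longrightarrow> \<exists>f. (\<forall>i. f i \<in> F) \<and> x = (\<Sum>i<m. f i * c i)"
proof (induction m arbitrary: x)
  case 0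
  then show ?case
    using zero_mem by auto
next
  case (Suc m)
  then obtain s a where x: "x = s + a * c m" "s \<in> lincombs c m" "a \<in> F"
    by auto
  with Suc.IH obtain f where "\<forall>i. f i \<in> F" "s = (\<Sum>i<m. f i * c i)"
    by metis
  with x show ?case
    by (intro exI[of _ "f(m := a)"]) auto
qed

lemma card_F_gt_1: "1 < card F"
proof -
  have "card {0, 1 :: 'a} \<le> card F"
    by (rule card_mono) (auto simp: zero_mem one_mem)
  then show ?thesis
    by simp
qed

lemma card_lincombs_le: "card (lincombs c m) \<le> card F ^ m"
proof (induction m)
  case (Suc m)
  have "card (lincombs c (Suc m)) \<le> card (lincombs c m \<times> F)"
    unfolding lincombs.simps by (rule card_image_le) simp
  also have "\<dots> \<le> card F ^ Suc m"
    using Suc by (simp add: card_cartesian_product)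
  finally show ?case .
qed simp

text \<open>If two expressions of one element differed in the last coefficient, dividing by the
  difference would put \<open>c m\<close> into the span of its predecessors.\<close>

lemma card_lincombs_eq: "lin_indep c m \<Longrightarrow> card (lincombs c m) = card F ^ m"
proof (induction m)
  case (Suc m)
  have c: "c m \<notin> lincombs c m"
    using Suc.prems by (simp add: lin_indep_def)
  have "inj_on (\<lambda>(s, a). s + a * c m) (lincombs c m \<times> F)"
  proof (rule inj_onI, clarify)
    fix s a t b
    assume st: "s \<in> lincombs c m" "t \<in> lincombs c m" and ab: "a \<in> F" "b \<in> F"
      and eq: "s + a * c m = t + b * c m"
    have "a = b"
    proof (rule ccontr)
      assume "a \<noteq> b"
      then have "c m = inverse (b - a) * (s - t)"
        using eq by (simp add: field_simps)
      then show False
        using c st ab by (metis lincombs_scale lincombs_diff inverse_mem diff_mem)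
    qed
    with eq show "s = t \<and> a = b"
      by simp
  qed
  then have "card (lincombs c (Suc m)) = card (lincombs c m \<times> F)"
    by (simp add: card_image)
  with Suc show ?case
    by (simp add: lin_indep_def card_cartesian_product)
qed simp

lemma lin_indep_imp_lincombs_UNIV:
  assumes "lin_indep c r" and "CARD('a) = card F ^ r"
  shows "lincombs c r = UNIV"
  by (rule card_subset_eq) (auto simp: card_lincombs_eq assms)

lemma lin_indep_upd:
  assumes "lin_indep c m" and "x \<notin> lincombs c m"
  shows "lin_indep (c(m := x)) (Suc m)"
proof -
  have "lincombs (c(m := x)) i = lincombs c i" if "i \<le> m" for i
    by (rule lincombs_cong) (use that in auto)
  with assms show ?thesis
    by (auto simp: lin_indep_def less_Suc_eq)
qed

text \<open>By counting, fewer than \<open>r\<close> generators cannot exhaust the field, so another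
  independent element is available.\<close>

lemma lin_indep_exists:
  assumes card: "CARD('a) = card F ^ r" and "m \<le> r"
  shows "\<exists>c. lin_indep c m"
  using \<open>m \<le> r\<close>
proof (induction m)
  case (Suc m)
  then obtain c where c: "lin_indep c m"
    by auto
  have "card (lincombs c m) < CARD('a)"
    using Suc.prems card_F_gt_1 c by (simp add: card card_lincombs_eq)
  then obtain x where "x \<notin> lincombs c m"
    by (metis UNIV_eq_I less_irrefl)
  with c show ?case
    using lin_indep_upd by blast
qed (simp add: lin_indep_def)

lemma lin_indep_nonzero: "\<lbrakk>lin_indep c m; i < m\<rbrakk> \<Longrightarrow> c i \<noteq> 0"
  using lincombs_zero[of c i] by (auto simp: lin_indep_def)

text \<open>The greedy choice never gets stuck: the \<open>i + 1\<close> independent elements \<open>u i * \<gamma> k\<close>,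
  \<open>k \<le> i\<close>, cannot all lie in the span of the \<open>i\<close> elements chosen before.\<close>

lemma greedy_lin_indep:
  assumes \<gamma>: "lin_indep \<gamma> r" and u: "\<And>i. u i \<noteq> 0" and "m \<le> r"
  shows "\<exists>\<kappa>. (\<forall>i. \<kappa> i \<le> i) \<and> lin_indep (\<lambda>i. u i * \<gamma> (\<kappa> i)) m"
  using \<open>m \<le> r\<close>
proof (induction m)
  case 0
  show ?case
    by (rule exI[of _ "\<lambda>i. i"]) (simp add: lin_indep_def)
next
  case (Suc m)
  then obtain \<kappa> where \<kappa>: "\<forall>i. \<kappa> i \<le> i" "lin_indep (\<lambda>i. u i * \<gamma> (\<kappa> i)) m"
    by auto
  define L where "L = lincombs (\<lambda>i. u i * \<gamma> (\<kappa> i)) m"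
  obtain k where k: "k \<le> m" "u m * \<gamma> k \<notin> L"
  proof (rule ccontr)
    assume "\<not> thesis"
    then have in_L: "u m * \<gamma> k \<in> L" if "k < Suc m" for k
      using that \<open>\<And>k. \<lbrakk>k \<le> m; u m * \<gamma> k \<notin> L\<rbrakk> \<Longrightarrow> thesis\<close> by (meson less_Suc_eq_le)
    have "(*) (u m) ` lincombs \<gamma> n \<subseteq> L" if "n \<le> Suc m" for n
      using that
    proof (induction n)
      case 0
      then show ?case
        by (simp add: L_def lincombs_zero)
    next
      case (Suc n)
      show ?case
      proof clarify
        fix x assume "x \<in> lincombs \<gamma> (Suc n)"
        then obtain s a where x: "x = s + a * \<gamma> n" "s \<in> lincombs \<gamma> n" "a \<in> F"
          by auto
        have "u m * s \<in> L" "a * (u m * \<gamma> n) \<in> L"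
          using Suc x in_L[of n] by (auto simp: L_def intro: lincombs_scale)
        then have "u m * s + a * (u m * \<gamma> n) \<in> L"
          unfolding L_def by (rule lincombs_add)
        then show "u m * x \<in> L"
          by (simp add: x algebra_simps)
      qed
    qed
    \<comment> \<open>Multiplication by \<open>u m\<close> is injective, so \<open>L\<close> would
      have at least \<open>card F ^ Suc m\<close> elements, too many for \<open>m\<close>
      generators.\<close>
    then have "card ((*) (u m) ` lincombs \<gamma> (Suc m)) \<le> card L"
      by (intro card_mono) (simp_all del: lincombs.simps)
    moreover have "lin_indep \<gamma> (Suc m)"
      using \<gamma> Suc.prems by (auto simp: lin_indep_def)
    then have "card ((*) (u m) ` lincombs \<gamma> (Suc m)) = card F ^ Suc m"
      using card_image[of "(*) (u m)" "lincombs \<gamma> (Suc m)"] u[of m] card_lincombs_eq[of \<gamma> "Suc m"]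
      by (simp add: inj_on_def del: lincombs.simps)
    moreover have "card L \<le> card F ^ m"
      unfolding L_def by (rule card_lincombs_le)
    ultimately have "card F ^ Suc m \<le> card F ^ m"
      by linarith
    then show False
      using card_F_gt_1 by (simp add: power_increasing_iff)
  qed
  have "lin_indep ((\<lambda>i. u i * \<gamma> (\<kappa> i))(m := u m * \<gamma> k)) (Suc m)"
    using \<kappa>(2) k(2) unfolding L_def by (rule lin_indep_upd)
  moreover have "(\<lambda>i. u i * \<gamma> (\<kappa> i))(m := u m * \<gamma> k) = (\<lambda>i. u i * \<gamma> ((\<kappa>(m := k)) i))"
    by auto
  ultimately show ?case
    using \<kappa>(1) k(1) by (intro exI[of _ "\<kappa>(m := k)"]) auto
qed

end

section \<open>Covering numbers of vector sets\<close>

text \<open>The vector form of saturation: with \<open>m = Suc \<rho>\<close>, a bound on the number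
  of vectors replaces the bound \<rho> on the projective dimension.\<close>

definition spans_with :: "nat \<Rightarrow> ('a::field ^ 'n) set \<Rightarrow> bool" where
  "spans_with m A \<longleftrightarrow> (\<forall>x. \<exists>T\<subseteq>A. card T \<le> m \<and> x \<in> vec.span T)"

lemma spans_with_imp_span: "spans_with m A \<Longrightarrow> vec.span A = UNIV"
  unfolding spans_with_def by (metis UNIV_eq_I subsetD vec.span_mono)

text \<open>The sum of all basis vectors lies in the span of no proper subset of the basis.\<close>

lemma basis_not_spans_with:
  fixes B :: "('a::{field,finite} ^ 'n) set"
  assumes "vec.independent B" and "m < card B"
  shows "\<not> spans_with m B"
proof
  assume "spans_with m B"
  then obtain T where T: "T \<subseteq> B" "card T \<le> m" "(\<Sum>b\<in>B. b) \<in> vec.span T"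
    unfolding spans_with_def by blast
  have "T \<noteq> B"
    using T assms by auto
  with T obtain b where b: "b \<in> B" "b \<notin> T"
    by blast
  have "(\<Sum>b\<in>B. b) = b + (\<Sum>c\<in>B - {b}. c)"
    using b by (simp add: sum.remove)
  moreover have "(\<Sum>c\<in>B - {b}. c) \<in> vec.span (B - {b})"
    by (intro vec.span_sum vec.span_base)
  moreover have "(\<Sum>b\<in>B. b) \<in> vec.span (B - {b})"
    using T b vec.span_mono[of T "B - {b}"] by blast
  ultimately have "b \<in> vec.span (B - {b})"
    by (metis add_diff_cancel_right' vec.span_diff)
  with b assms(1) show False
    by (auto simp: vec.dependent_def)
qed

text \<open>Subtracting a multiple of a basis vector \<open>b \<in> A\<close> from a single vector of \<open>A\<close> raises the
  covering number by at most one, and such moves turn \<open>A\<close> into the basis, whose covering number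
  is the dimension. Hence every value in between is attained on the way.\<close>

lemma exact_spans_with:
  fixes A B :: "('a::{field,finite} ^ 'n) set"
  assumes "spans_with (Suc m) A" "0 \<notin> A" "B \<subseteq> A"
    and B: "vec.independent B" "vec.span B = UNIV" "m < card B"
  shows "\<exists>A' :: ('a ^ 'n) set. card A' \<le> card A \<and> 0 \<notin> A' \<and> spans_with (Suc m) A' \<and> \<not> spans_with m A'"
  using assms(1-3)
\<comment> \<open>The measure is the total number of nonzero \<open>B\<close>-coordinates of the
  vectors outside \<open>B\<close>; each move lowers it.\<close>
proof (induction "\<Sum>v\<in>A - B. card {b. vec.representation B v b \<noteq> 0}" arbitrary: A
    rule: less_induct)
  case less
  let ?supp = "\<lambda>v. {b. vec.representation B v b \<noteq> 0}"
  show ?case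
  proof (cases "spans_with m A")
    case False
    then show ?thesis
      using less.prems by (intro exI[of _ A]) simp
  next
    case True
    then have "A \<noteq> B"
      using basis_not_spans_with[OF B(1,3)] by auto
    then obtain v where v: "v \<in> A" "v \<notin> B"
      using less.prems(3) by blast
    have "?supp v \<noteq> {}"
    proof
      assume "?supp v = {}"
      then have "v = 0"
        using vec.sum_nonzero_representation_eq[of B v] B by simp
      with v less.prems show False
        by simp
    qed
    then obtain b where b: "vec.representation B v b \<noteq> 0"
      by blast
    then have "b \<in> B"
      by (rule vec.representation_ne_zero)
    define r where "r = vec.representation B v b"
    define v' where "v' = v - r *s b"
    have rep: "vec.representation B v' = (\<lambda>c. vec.representation B v c - r * (if c = b then 1 else 0))"
      unfolding v'_def using B \<open>b \<in> B\<close>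
      by (simp add: vec.representation_diff vec.representation_scale vec.representation_basis)
    have supp: "?supp v' = ?supp v - {b}"
      by (auto simp: rep r_def split: if_splits)
    \<comment> \<open>If \<open>v'\<close> is zero, \<open>v\<close> is merely removed, which keeps
      zero out of the set.\<close>
    define A1 where "A1 = (A - {v}) \<union> ({v'} - {0})"
    have card_A1: "card A1 \<le> card A"
    proof -
      have "card A1 \<le> card (A - {v}) + card ({v'} - {0})"
        unfolding A1_def by (rule card_Un_le)
      also have "card ({v'} - {0}) \<le> 1"
        using card_mono[of "{v'}" "{v'} - {0}"] by simp
      also have "card (A - {v}) + 1 \<le> card A"
        using card_Diff1_less[of A v] v by simp
      finally show ?thesis
        by simp
    qed
    have "(\<Sum>w\<in>A1 - B. card (?supp w)) \<le> (\<Sum>w\<in>insert v' (A - B - {v}). card (?supp w))"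
      by (rule sum_mono2) (auto simp: A1_def)
    also have "\<dots> \<le> card (?supp v') + (\<Sum>w\<in>A - B - {v}. card (?supp w))"
      by (simp add: sum.insert_if)
    also have "\<dots> < card (?supp v) + (\<Sum>w\<in>A - B - {v}. card (?supp w))"
      unfolding supp using b by (simp add: card_Diff1_less del: card_Diff_insert)
    also have "\<dots> = (\<Sum>w\<in>A - B. card (?supp w))"
      using v by (subst sum.remove[of "A - B" v]) auto
    finally have decr: "(\<Sum>w\<in>A1 - B. card (?supp w)) < (\<Sum>w\<in>A - B. card (?supp w))" .
    have "spans_with (Suc m) A1"
      unfolding spans_with_def
    proof
      fix x
      obtain T where T: "T \<subseteq> A" "card T \<le> m" "x \<in> vec.span T"
        using True unfolding spans_with_def by blast
      show "\<exists>T\<subseteq>A1. card T \<le> Suc m \<and> x \<in> vec.span T"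
      proof (cases "v \<in> T")
        case False
        with T show ?thesis
          by (intro exI[of _ T]) (auto simp: A1_def)
      next
        case vT: True
        \<comment> \<open>As \<open>v = v' + r *s b\<close>, trading \<open>v\<close> for
          \<open>v'\<close> and \<open>b\<close> costs one additional vector: hence
          \<open>Suc m\<close>.\<close>
        define T' where "T' = (T - {v}) \<union> ({b} \<union> ({v'} - {0}))"
        have "b \<noteq> v"
          using \<open>b \<in> B\<close> v by blast
        then have "T' \<subseteq> A1"
          using T \<open>b \<in> B\<close> less.prems by (auto simp: T'_def A1_def)
        moreover have "card T' \<le> Suc m"
        proof -
          have "card T' \<le> card (T - {v}) + card ({b} \<union> ({v'} - {0}))"
            unfolding T'_def by (rule card_Un_le)
          moreover have "card ({b} \<union> ({v'} - {0})) \<le> card {b, v'}"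
            by (rule card_mono) auto
          moreover have "card {b, v'} \<le> 2"
            by (simp add: card_insert_if)
          moreover have "card (T - {v}) < card T"
            using vT by (simp add: card_Diff1_less del: card_Diff_insert)
          ultimately show ?thesis
            using T(2) by linarith
        qed
        moreover have "x \<in> vec.span T'"
        proof -
          have "v' \<in> vec.span T'"
            by (cases "v' = 0") (auto simp: T'_def vec.span_zero intro: vec.span_base)
          moreover have "b \<in> vec.span T'"
            by (auto simp: T'_def intro: vec.span_base)
          ultimately have "v' + r *s b \<in> vec.span T'"
            by (intro vec.span_add vec.span_scale)
          then have "v \<in> vec.span T'"
            by (simp add: v'_def)
          then have "T \<subseteq> vec.span T'"
            by (auto simp: T'_def intro: vec.span_base)
          then have "vec.span T \<subseteq> vec.span T'"
            by (simp add: vec.span_minimal)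
          with T show ?thesis
            by blast
        qed
        ultimately show ?thesis
          by blast
      qed
    qed
    moreover have "0 \<notin> A1" "B \<subseteq> A1"
      using less.prems v by (auto simp: A1_def)
    ultimately show ?thesis
      using less.hyps[OF decr] card_A1 by (meson order.trans)
  qed
qed

section \<open>From spanning vector sets to saturating point sets\<close>

lemma pg_span_lines: "pg_span ((\<lambda>v. vec.span {v}) ` T) = vec.span T"
proof (rule antisym)
  have "vec.span {v} \<subseteq> vec.span T" if "v \<in> T" for v
    using that by (intro vec.span_mono) auto
  then show "pg_span ((\<lambda>v. vec.span {v}) ` T) \<subseteq> vec.span T"
    unfolding pg_span_def by (intro vec.span_minimal) auto
  show "vec.span T \<subseteq> pg_span ((\<lambda>v. vec.span {v}) ` T)"
    unfolding pg_span_def by (intro vec.span_mono) (auto intro: vec.span_base)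
qed

lemma line_in_pg_points:
  assumes "v \<noteq> 0"
  shows "vec.span {v} \<in> (pg_points :: ('a::{field,finite} ^ 'n) set set)"
  using assms by (simp add: pg_points_def vec.dim_span_eq_card_independent)

text \<open>A spanning subset may be redundant, so a basis \<open>C\<close> of it turns the
  dimension bound into a cardinality bound. The \<open>Suc\<close> is the shift from projective to
  linear dimension.\<close>

lemma saturated_by_lines_iff:
  fixes A :: "('a::{field,finite} ^ 'n) set"
  shows "(\<forall>P\<in>pg_points. saturated_by \<sigma> ((\<lambda>v. vec.span {v}) ` A) P) \<longleftrightarrow> spans_with (Suc \<sigma>) A"
    (is "?L \<longleftrightarrow> ?R")
proof
  assume L: ?L
  show ?R
    unfolding spans_with_def
  proof
    fix x :: "'a ^ 'n"
    show "\<exists>T\<subseteq>A. card T \<le> Suc \<sigma> \<and> x \<in> vec.span T"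
    proof (cases "x = 0")
      case True
      then show ?thesis
        by (intro exI[of _ "{}"]) auto
    next
      case False
      have "saturated_by \<sigma> ((\<lambda>v. vec.span {v}) ` A) (vec.span {x})"
        by (rule bspec[OF L line_in_pg_points[OF False]])
      then obtain T where T: "T \<subseteq> (\<lambda>v. vec.span {v}) ` A" "vec.span {x} \<subseteq> pg_span T"
        "pg_dim (pg_span T) \<le> int \<sigma>"
        unfolding saturated_by_def by auto
      obtain T0 where "T0 \<subseteq> A" "T = (\<lambda>v. vec.span {v}) ` T0"
        using T(1) by (rule subset_imageE)
      with T have T0: "T0 \<subseteq> A" "vec.span {x} \<subseteq> vec.span T0" "pg_dim (vec.span T0) \<le> int \<sigma>"
        by (simp_all add: pg_span_lines)
      obtain C where C: "C \<subseteq> T0" "vec.independent C" "T0 \<subseteq> vec.span C" "card C = vec.dim T0"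
        using vec.basis_exists by metis
      have "card C \<le> Suc \<sigma>"
        using T0(3) C(4) by (simp add: pg_dim_def)
      moreover have "x \<in> vec.span C"
        using T0(2) C(3) vec.span_base[of x "{x}"] vec.span_minimal[OF C(3)] by auto
      ultimately show ?thesis
        using C T0 by blast
    qed
  qed
next
  assume R: ?R
  show ?L
  proof
    fix P :: "('a ^ 'n) set" assume "P \<in> pg_points"
    then have P: "vec.subspace P" "vec.dim P = 1"
      by (auto simp: pg_points_def)
    obtain C where C: "C \<subseteq> P" "P \<subseteq> vec.span C" "card C = 1"
      using vec.basis_exists[of P] P by metis
    then obtain x where x: "P \<subseteq> vec.span {x}"
      by (metis card_1_singletonE)
    obtain T where T: "T \<subseteq> A" "card T \<le> Suc \<sigma>" "x \<in> vec.span T"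
      using R unfolding spans_with_def by blast
    have "vec.dim T \<le> card T"
      by (rule vec.dim_le_card) (auto intro: vec.span_base)
    moreover have "P \<subseteq> vec.span T"
      using x T(3) vec.span_minimal[of "{x}" "vec.span T"] by auto
    ultimately show "saturated_by \<sigma> ((\<lambda>v. vec.span {v}) ` A) P"
      unfolding saturated_by_def using T
      by (intro exI[of _ "(\<lambda>v. vec.span {v}) ` T"]) (auto simp: pg_span_lines pg_dim_def)
  qed
qed

text \<open>\<open>A\<close> contains a basis, of size \<open>CARD('n) > \<rho>\<close>, so
  \<open>exact_spans_with\<close> yields a set, no larger, for which \<rho> is the least possible
  value.\<close>

lemma min_saturating_size_le:
  fixes A :: "('a::{field,finite} ^ 'n::finite) set"
  assumes A: "spans_with (Suc \<rho>) A" "0 \<notin> A" and \<rho>: "\<rho> < CARD('n)"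
  shows "min_saturating_size TYPE('a) TYPE('n) \<rho> \<le> card A"
proof -
  obtain B where B: "B \<subseteq> A" "vec.independent B" "A \<subseteq> vec.span B" "card B = vec.dim A"
    using vec.basis_exists by metis
  have "vec.span B = UNIV"
    using vec.span_minimal[OF B(3)] spans_with_imp_span[OF A(1)] by auto
  moreover have "card B = CARD('n)"
    using B(4) spans_with_imp_span[OF A(1)] by (metis vec.dim_span vec_dim_card)
  ultimately obtain A' :: "('a ^ 'n) set" where A': "card A' \<le> card A" "0 \<notin> A'" "spans_with (Suc \<rho>) A'"
    "\<not> spans_with \<rho> A'"
    using exact_spans_with[OF A B(1,2)] \<rho> by auto
  define S where "S = (\<lambda>v. vec.span {v}) ` A'"
  have "\<rho> \<le> \<sigma>" if "\<forall>P\<in>pg_points. saturated_by \<sigma> S P" for \<sigma>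
  proof (rule ccontr)
    assume "\<not> \<rho> \<le> \<sigma>"
    then have "Suc \<sigma> \<le> \<rho>"
      by simp
    moreover have "spans_with (Suc \<sigma>) A'"
      using that unfolding S_def by (rule iffD1[OF saturated_by_lines_iff])
    ultimately have "spans_with \<rho> A'"
      unfolding spans_with_def by (meson order.trans)
    with A' show False
      by blast
  qed
  moreover have "S \<subseteq> pg_points"
    using A'(2) unfolding S_def by (intro image_subsetI line_in_pg_points) metis
  ultimately have "saturating_set \<rho> S"
    using iffD2[OF saturated_by_lines_iff A'(3)] unfolding saturating_set_def S_def by blast
  then have "min_saturating_size TYPE('a) TYPE('n) \<rho> \<le> card S"
    unfolding min_saturating_size_def by (intro Least_le) blast
  also have "card S \<le> card A'"
    unfolding S_def by (rule card_image_le) simp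
  finally show ?thesis
    using A'(1) by simp
qed

section \<open>The construction\<close>

text \<open>\<open>g\<close> gives the index type the order that blocks and tails refer to. By
  \<open>card_field\<close>, \<gamma> is an \<open>F\<close>-basis of the field.\<close>

locale block_construction = subfield_set F for F :: "'a::{field,finite} set" +
  fixes \<gamma> :: "nat \<Rightarrow> 'a" and r :: nat and g :: "'n::finite \<Rightarrow> nat"
  assumes r_pos: "0 < r"
    and card_field: "CARD('a) = card F ^ r"
    and \<gamma>: "lin_indep \<gamma> r"
    and g: "bij_betw g UNIV {..<CARD('n)}"
begin

text \<open>For \<open>j \<ge> CARD('n)\<close> no coordinate matches and \<open>e j\<close> is
  zero, so positions must be kept in range.\<close>

definition e :: "nat \<Rightarrow> 'a ^ 'n" where
  "e j = (\<chi> t. if g t = j then 1 else 0)"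

definition tails :: "nat \<Rightarrow> ('a ^ 'n) set" where
  "tails n = {a. \<forall>t. a $ t \<in> F \<and> (g t < n \<longrightarrow> a $ t = 0)}"

definition block :: "nat \<Rightarrow> ('a ^ 'n) set" where
  "block b = (\<Union>i<r. insert (e (b * r + i))
     (\<Union>k\<le>i. (\<lambda>a. e (b * r + i) + \<gamma> k *s a) ` (tails (Suc b * r) - {0})))"

lemma e_nth: "e j $ t = (if g t = j then 1 else 0)"
  by (simp add: e_def)

lemma g_eq_iff: "g t = g t' \<longleftrightarrow> t = t'"
  using g by (auto simp: bij_betw_def inj_on_def)

lemma g_less: "g t < CARD('n)"
  using g by (auto simp: bij_betw_def)

lemma obtain_coordinate:
  assumes "j < CARD('n)"
  obtains t where "g t = j"
  using assms g by (metis bij_betw_def imageE lessThan_iff)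

lemma card_coordinates_ge: "card {t. n \<le> g t} = CARD('n) - n"
proof -
  have "g ` {t. n \<le> g t} = {n..<CARD('n)}"
    using g_less by (auto simp: image_iff) (metis obtain_coordinate)
  moreover have "inj_on g {t. n \<le> g t}"
    by (simp add: inj_on_def g_eq_iff)
  ultimately show ?thesis
    by (metis card_image card_atLeastLessThan)
qed

lemma zero_in_tails: "0 \<in> tails n"
  by (simp add: tails_def zero_mem)

lemma add_in_tails: "\<lbrakk>a \<in> tails n; a' \<in> tails n\<rbrakk> \<Longrightarrow> a + a' \<in> tails n"
  by (simp add: tails_def add_mem)

lemma e_in_tails: "n \<le> j \<Longrightarrow> e j \<in> tails n"
  by (auto simp: tails_def e_nth zero_mem one_mem)

lemma card_tails_le: "card (tails n) \<le> card F ^ (CARD('n) - n)"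
proof -
  let ?I = "{t. n \<le> g t}"
  let ?h = "\<lambda>a :: 'a ^ 'n. restrict (\<lambda>t. a $ t) ?I"
  have "inj_on ?h (tails n)"
  proof (rule inj_onI)
    fix a a' assume a: "a \<in> tails n" "a' \<in> tails n" and eq: "?h a = ?h a'"
    have "a $ t = a' $ t" for t
      using a fun_cong[OF eq, of t] by (cases "n \<le> g t") (auto simp: tails_def)
    then show "a = a'"
      by (simp add: vec_eq_iff)
  qed
  moreover have "?h ` tails n \<subseteq> ?I \<rightarrow>\<^sub>E F"
    by (intro image_subsetI) (simp add: tails_def restrict_PiE_iff)
  ultimately have "card (tails n) \<le> card (?I \<rightarrow>\<^sub>E F)"
    by (rule card_inj_on_le) (simp add: finite_PiE)
  also have "\<dots> = card F ^ (CARD('n) - n)"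
    by (simp add: card_PiE card_coordinates_ge)
  finally show ?thesis .
qed

lemma block_memI:
  assumes "i < r" "k \<le> i" "a \<in> tails (Suc b * r)"
  shows "e (b * r + i) + \<gamma> k *s a \<in> block b"
proof (cases "a = 0")
  case True
  then show ?thesis
    using assms(1) by (auto simp: block_def)
next
  case False
  then show ?thesis
    using assms unfolding block_def by blast
qed

lemma card_block_le:
  "card (block b) \<le> (\<Sum>i<r. 1 + Suc i * (card F ^ (CARD('n) - Suc b * r) - 1))"
  unfolding block_def
proof (rule order.trans[OF card_UN_le sum_mono])
  fix i
  let ?A = "tails (Suc b * r) - {0}"
  let ?U = "\<Union>k\<le>i. (\<lambda>a. e (b * r + i) + \<gamma> k *s a) ` ?A"
  have "card ?A \<le> card F ^ (CARD('n) - Suc b * r) - 1"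
    using card_tails_le[of "Suc b * r"] zero_in_tails[of "Suc b * r"]
    by (simp add: card_Diff_singleton)
  then have "card ((\<lambda>a. e (b * r + i) + \<gamma> k *s a) ` ?A) \<le> card F ^ (CARD('n) - Suc b * r) - 1" for k
    by (rule order.trans[OF card_image_le, rotated]) simp
  then have "card ?U \<le> (\<Sum>k\<le>i. card F ^ (CARD('n) - Suc b * r) - 1)"
    by (intro order.trans[OF card_UN_le sum_mono]) auto
  then have "card ?U \<le> Suc i * (card F ^ (CARD('n) - Suc b * r) - 1)"
    by simp
  moreover have "card (insert (e (b * r + i)) ?U) \<le> 1 + card ?U"
    by (simp add: card_insert_if)
  ultimately show "card (insert (e (b * r + i)) ?U) \<le> 1 + Suc i * (card F ^ (CARD('n) - Suc b * r) - 1)"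
    by linarith
qed simp

text \<open>At position \<open>b * r + i\<close> such a vector has entry 1, because \<open>a\<close>
  is supported behind the block.\<close>

lemma zero_notin_block:
  assumes "Suc b * r \<le> CARD('n)"
  shows "0 \<notin> block b"
proof
  assume "0 \<in> block b"
  then obtain i k a where i: "i < r" and a: "a \<in> tails (Suc b * r)"
    and eq: "e (b * r + i) + \<gamma> k *s a = 0"
    unfolding block_def using zero_in_tails[of "Suc b * r"]
    by (fastforce simp: image_iff)
  obtain t where t: "g t = b * r + i"
    using obtain_coordinate[of "b * r + i"] i assms by auto
  have "a $ t = 0"
    using a t i by (simp add: tails_def)
  moreover have "(e (b * r + i) + \<gamma> k *s a) $ t = 1 + \<gamma> k * a $ t"
    by (simp add: e_nth t)
  ultimately show False
    using eq by simp
qed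

section \<open>Covering a vector by few points of one block\<close>

lemma block_spans:
  assumes b: "Suc b * r \<le> CARD('n)"
    and before: "\<And>t. g t < b * r \<Longrightarrow> x $ t = 0"
    and nz: "b * r \<le> g t\<^sub>0" "g t\<^sub>0 < Suc b * r" "x $ t\<^sub>0 \<noteq> 0"
  shows "\<exists>T\<subseteq>block b. card T \<le> r \<and> x \<in> vec.span T"
proof -
  define \<xi> where "\<xi> i = x $ inv_into UNIV g (b * r + i)" for i
  have x_nth: "x $ t = \<xi> i" if "g t = b * r + i" for t i
    unfolding \<xi>_def that[symmetric] by (simp add: inv_f_f inj_def g_eq_iff)
  \<comment> \<open>The default 1 keeps all factors nonzero, as the greedy choice requires.\<close>
  define u where "u i = (if \<xi> i = 0 then 1 else \<xi> i)" for i
  have u_nz: "u i \<noteq> 0" for i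
    by (simp add: u_def)
  obtain \<kappa> where \<kappa>: "\<forall>i. \<kappa> i \<le> i" and indep: "lin_indep (\<lambda>i. u i * \<gamma> (\<kappa> i)) r"
    using greedy_lin_indep[OF \<gamma>, of u r] u_nz by blast
  define c where "c i = u i * \<gamma> (\<kappa> i)" for i
  have "lincombs c r = UNIV"
    unfolding c_def using indep card_field by (rule lin_indep_imp_lincombs_UNIV)
  then have "\<forall>t. \<exists>f. (\<forall>i. f i \<in> F) \<and> x $ t = (\<Sum>i<r. f i * c i)"
    using lincombs_imp_sum by blast
  then obtain \<phi> where \<phi>: "\<And>t i. \<phi> t i \<in> F" "\<And>t. x $ t = (\<Sum>i<r. \<phi> t i * c i)"
    by metis
  \<comment> \<open>Behind the block, \<open>x\<close> is the sum of the
    \<open>c i *s f i\<close>.\<close>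
  define f :: "nat \<Rightarrow> 'a ^ 'n" where
    "f i = (\<chi> t. if g t < Suc b * r then 0 else \<phi> t i)" for i
  have f: "f i \<in> tails (Suc b * r)" for i
    using \<phi>(1) zero_mem by (simp add: tails_def f_def)
  define i\<^sub>0 where "i\<^sub>0 = g t\<^sub>0 - b * r"
  have i\<^sub>0: "i\<^sub>0 < r" "\<xi> i\<^sub>0 \<noteq> 0"
    using nz x_nth[of t\<^sub>0 i\<^sub>0] by (auto simp: i\<^sub>0_def)
  \<comment> \<open>If \<open>\<xi> i\<close> is nonzero, \<open>\<xi> i *s v i\<close> supplies
    both the entry at \<open>b * r + i\<close> and \<open>c i *s f i\<close>. Otherwise the point is
    based at \<open>i\<^sub>0\<close>, where \<open>x\<close> does not vanish, and subtracting
    \<open>v i\<^sub>0\<close> leaves a nonzero multiple of \<open>f i\<close>.\<close>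
  define v where "v i = (if \<xi> i \<noteq> 0 then e (b * r + i) + \<gamma> (\<kappa> i) *s f i
    else e (b * r + i\<^sub>0) + \<gamma> (\<kappa> i\<^sub>0) *s (f i\<^sub>0 + f i))" for i
  define T where "T = v ` {..<r}"
  have "T \<subseteq> block b"
    using \<kappa> f i\<^sub>0 by (auto simp: T_def v_def intro!: block_memI add_in_tails)
  moreover have "card T \<le> r"
    unfolding T_def using card_image_le[of "{..<r}" v] by simp
  moreover have "x \<in> vec.span T"
  proof -
    have v_span: "v i \<in> vec.span T" if "i < r" for i
      using that by (intro vec.span_base) (simp add: T_def)
    have \<gamma>_nz: "\<gamma> (\<kappa> i\<^sub>0) \<noteq> 0"
      using lin_indep_nonzero[OF \<gamma>] \<kappa> i\<^sub>0 by (meson le_less_trans)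
    have part: "\<xi> i *s e (b * r + i) + c i *s f i \<in> vec.span T" if i: "i < r" for i
    proof (cases "\<xi> i = 0")
      case False
      then have "\<xi> i *s e (b * r + i) + c i *s f i = \<xi> i *s v i"
        by (simp add: v_def c_def u_def vec.scale_right_distrib)
      then show ?thesis
        using v_span[OF i] by (simp add: vec.span_scale)
    next
      case True
      then have "v i - v i\<^sub>0 = \<gamma> (\<kappa> i\<^sub>0) *s f i"
        using i\<^sub>0 by (simp add: v_def vec.scale_right_distrib)
      then have "\<xi> i *s e (b * r + i) + c i *s f i = (c i / \<gamma> (\<kappa> i\<^sub>0)) *s (v i - v i\<^sub>0)"
        using True \<gamma>_nz by simp
      then show ?thesis
        using v_span[OF i] v_span[OF i\<^sub>0(1)] by (simp add: vec.span_scale vec.span_diff)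
    qed
    have "x = (\<Sum>i<r. \<xi> i *s e (b * r + i) + c i *s f i)"
    proof (subst vec_eq_iff, rule allI)
      fix t
      have *: "(\<Sum>i<r. \<xi> i *s e (b * r + i) + c i *s f i) $ t =
          (\<Sum>i<r. \<xi> i * (if g t = b * r + i then 1 else 0)) + (\<Sum>i<r. c i * f i $ t)"
        by (simp add: sum.distrib e_nth)
      consider "g t < b * r" | "b * r \<le> g t" "g t < Suc b * r" | "Suc b * r \<le> g t"
        by linarith
      then show "x $ t = (\<Sum>i<r. \<xi> i *s e (b * r + i) + c i *s f i) $ t"
      proof cases
        case 1
        then show ?thesis
          unfolding * using before[of t] by (simp add: f_def)
      next
        case 2
        define i where "i = g t - b * r"
        have i: "g t = b * r + i" "i < r"
          using 2 by (auto simp: i_def)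
        have "(\<Sum>j<r. \<xi> j * (if g t = b * r + j then 1 else 0)) = (\<Sum>j<r. if i = j then \<xi> j else 0)"
          by (rule sum.cong) (auto simp: i)
        also have "\<dots> = x $ t"
          using i x_nth[of t i] by simp
        finally show ?thesis
          unfolding * using 2 by (simp add: f_def)
      next
        case 3
        then have "(\<Sum>i<r. \<xi> i * (if g t = b * r + i then 1 else 0)) = 0"
          by (intro sum.neutral) auto
        then show ?thesis
          unfolding * using 3 \<phi>(2)[of t] by (simp add: f_def mult.commute)
      qed
    qed
    also have "\<dots> \<in> vec.span T"
      by (rule vec.span_sum) (simp add: part)
    finally show ?thesis .
  qed
  ultimately show ?thesis
    by blast
qed

lemma eq_sum_e:
  assumes "\<And>t. g t < n \<Longrightarrow> x $ t = 0"
  shows "x = (\<Sum>t | n \<le> g t. x $ t *s e (g t))"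
proof (subst vec_eq_iff, rule allI)
  fix s
  have "(\<Sum>t | n \<le> g t. x $ t *s e (g t)) $ s = (\<Sum>t | n \<le> g t. x $ t * (if s = t then 1 else 0))"
    by (simp add: e_nth g_eq_iff)
  also have "\<dots> = (\<Sum>t | n \<le> g t. if s = t then x $ t else 0)"
    by (rule sum.cong) auto
  also have "\<dots> = x $ s"
    using assms[of s] by simp
  finally show "x $ s = (\<Sum>t | n \<le> g t. x $ t *s e (g t)) $ s"
    by simp
qed

text \<open>Differences with \<open>e (b * r)\<close> isolate the unit vectors behind the block,
  using one point more than there are such coordinates; hence the strict inequality.\<close>

lemma block_spans_tail:
  assumes tail: "\<And>t. g t < Suc b * r \<Longrightarrow> x $ t = 0" and short: "CARD('n) - Suc b * r < r"
  shows "\<exists>T\<subseteq>block b. card T \<le> r \<and> x \<in> vec.span T"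
proof -
  let ?w = "\<lambda>t. e (b * r) + \<gamma> 0 *s e (g t)"
  define T where "T = insert (e (b * r)) (?w ` {t. Suc b * r \<le> g t})"
  have "T \<subseteq> block b"
    using block_memI[OF r_pos, of 0 _ b] zero_in_tails[of "Suc b * r"] e_in_tails[of "Suc b * r"]
    by (force simp: T_def)
  moreover have "card T \<le> Suc (CARD('n) - Suc b * r)"
    unfolding T_def using card_image_le[of "{t. Suc b * r \<le> g t}" ?w]
    by (intro order.trans[OF card_insert_le_m1]) (auto simp: card_coordinates_ge)
  then have "card T \<le> r"
    using short by linarith
  moreover have "x \<in> vec.span T"
  proof -
    have "\<gamma> 0 \<noteq> 0"
      using lin_indep_nonzero[OF \<gamma> r_pos] .
    have "e (g t) \<in> vec.span T" if "Suc b * r \<le> g t" for t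
    proof -
      have "?w t - e (b * r) \<in> vec.span T"
        using that by (intro vec.span_diff vec.span_base) (auto simp: T_def)
      then have "inverse (\<gamma> 0) *s (?w t - e (b * r)) \<in> vec.span T"
        by (rule vec.span_scale)
      moreover have "inverse (\<gamma> 0) *s (?w t - e (b * r)) = e (g t)"
        using \<open>\<gamma> 0 \<noteq> 0\<close> by simp
      ultimately show ?thesis
        by metis
    qed
    then show ?thesis
      by (subst eq_sum_e[OF tail]) (auto intro!: vec.span_sum vec.span_scale)
  qed
  ultimately show ?thesis
    by blast
qed

lemma units_span_tail:
  assumes tail: "\<And>t. g t < n \<Longrightarrow> x $ t = 0" and short: "CARD('n) - n \<le> r"
  shows "\<exists>T\<subseteq>e ` {n..<CARD('n)}. card T \<le> r \<and> x \<in> vec.span T"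
proof (intro exI[of _ "e ` {n..<CARD('n)}"] conjI)
  show "card (e ` {n..<CARD('n)}) \<le> r"
    using card_image_le[of "{n..<CARD('n)}" e] short by simp
  show "x \<in> vec.span (e ` {n..<CARD('n)})"
    by (subst eq_sum_e[OF tail], assumption, rule vec.span_sum, rule vec.span_scale,
        rule vec.span_base) (simp add: g_less)
qed simp

lemma blocks_spans_with:
  assumes k: "0 < k" "k * r \<le> CARD('n)" "CARD('n) \<le> Suc k * r"
    and U: "if CARD('n) = Suc k * r then U = e ` {k * r..<CARD('n)} else U = {}"
  shows "spans_with r ((\<Union>b<k. block b) \<union> U)"
  unfolding spans_with_def
proof
  fix x :: "'a ^ 'n"
  show "\<exists>T\<subseteq>(\<Union>b<k. block b) \<union> U. card T \<le> r \<and> x \<in> vec.span T"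
  proof (cases "\<forall>t. g t < k * r \<longrightarrow> x $ t = 0")
    case tail: True
    show ?thesis
    proof (cases "CARD('n) = Suc k * r")
      case True
      with U have "U = e ` {k * r..<CARD('n)}"
        by simp
      moreover have "\<exists>T\<subseteq>e ` {k * r..<CARD('n)}. card T \<le> r \<and> x \<in> vec.span T"
        by (rule units_span_tail) (use tail True in auto)
      ultimately show ?thesis
        by (meson le_supI2)
    next
      case False
      obtain b where b: "k = Suc b"
        using k(1) gr0_conv_Suc by auto
      have "\<exists>T\<subseteq>block b. card T \<le> r \<and> x \<in> vec.span T"
        by (rule block_spans_tail) (use tail b k False in auto)
      moreover have "block b \<subseteq> (\<Union>b<k. block b) \<union> U"
        using b by blast
      ultimately show ?thesis
        by (meson order.trans)
    qed
  next
    case False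
    \<comment> \<open>The position of the first nonzero coordinate selects the block that covers
      \<open>x\<close>.\<close>
    define j where "j = (LEAST j. \<exists>t. g t = j \<and> x $ t \<noteq> 0)"
    obtain s where s: "g s < k * r" "x $ s \<noteq> 0"
      using False by auto
    have "\<exists>t. g t = j \<and> x $ t \<noteq> 0"
      unfolding j_def by (rule LeastI[of _ "g s"]) (use s in blast)
    then obtain t\<^sub>0 where t\<^sub>0: "g t\<^sub>0 = j" "x $ t\<^sub>0 \<noteq> 0"
      by blast
    have before: "x $ t = 0" if "g t < j" for t
      using that not_less_Least unfolding j_def by blast
    have "j \<le> g s"
      unfolding j_def by (rule Least_le) (use s in blast)
    then have "j < k * r"
      using s by simp
    define b where "b = j div r"
    have b: "b < k"
      unfolding b_def using \<open>j < k * r\<close> by (simp add: less_mult_imp_div_less)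
    have lo: "b * r \<le> j" and hi: "j < Suc b * r"
      using r_pos by (simp_all add: b_def dividend_less_times_div mult.commute)
    have "Suc b * r \<le> k * r"
      using b by (simp add: Suc_leI mult_le_mono1 del: mult_Suc)
    have "\<exists>T\<subseteq>block b. card T \<le> r \<and> x \<in> vec.span T"
    proof (rule block_spans)
      show "Suc b * r \<le> CARD('n)"
        using \<open>Suc b * r \<le> k * r\<close> k(2) by linarith
      show "x $ t = 0" if "g t < b * r" for t
        using before that lo by simp
    qed (use t\<^sub>0 lo hi in auto)
    moreover have "block b \<subseteq> (\<Union>b<k. block b) \<union> U"
      using b by blast
    ultimately show ?thesis
      by (meson order.trans)
  qed
qed

end

section \<open>Existence of the data and the resulting size bound\<close>

lemma block_construction_exists:
  assumes "primepow Q" and "0 < r" and card: "CARD('a::{field,finite}) = Q ^ r"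
  obtains F :: "'a::{field,finite} set" and \<gamma> and g :: "'n::finite \<Rightarrow> nat"
  where "block_construction F \<gamma> r g" "card F = Q"
proof -
  obtain p m where p: "prime p" and Q: "Q = p ^ m"
    using assms(1) unfolding primepow_def by auto
  define F where "F = {x :: 'a. x ^ Q = x}"
  have "CARD('a) = p ^ (m * r)"
    by (simp add: card Q power_mult)
  then interpret subfield_set F
    unfolding F_def Q by (rule subfield_set_fixed_points[OF p])
  have card_F: "card F = Q"
    unfolding F_def using primepow_gt_Suc_0[OF assms(1)] card \<open>0 < r\<close>
    by (intro card_fixed_points) auto
  obtain \<gamma> where "lin_indep \<gamma> r"
    using lin_indep_exists[of r r] card card_F by auto
  moreover obtain g :: "'n \<Rightarrow> nat" where "bij_betw g UNIV {..<CARD('n)}"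
    using ex_bij_betw_finite_nat[of "UNIV :: 'n set"] by (auto simp: atLeast0LessThan)
  ultimately have "block_construction F \<gamma> r g"
    using \<open>0 < r\<close> card card_F by unfold_locales auto
  then show ?thesis
    using card_F that by blast
qed

lemma min_saturating_size_le_blocks:
  assumes "primepow Q" and card_a: "CARD('a::{field,finite}) = Q ^ Suc \<rho>"
    and k: "0 < k" "k * Suc \<rho> < CARD('n::finite)" "CARD('n) \<le> Suc k * Suc \<rho>"
  shows "min_saturating_size TYPE('a) TYPE('n) \<rho> \<le>
    (\<Sum>b<k. \<Sum>i<Suc \<rho>. 1 + Suc i * (Q ^ (CARD('n) - Suc b * Suc \<rho>) - 1))
      + (if CARD('n) = Suc k * Suc \<rho> then Suc \<rho> else 0)"
proof -
  obtain F :: "'a set" and \<gamma> and g :: "'n \<Rightarrow> nat"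
    where bc: "block_construction F \<gamma> (Suc \<rho>) g" and card_F: "card F = Q"
    using block_construction_exists[OF assms(1) _ card_a, where ?'n = 'n] by blast
  interpret block_construction F \<gamma> "Suc \<rho>" g
    by (fact bc)
  define U where "U = (if CARD('n) = Suc k * Suc \<rho> then e ` {k * Suc \<rho>..<CARD('n)} else {})"
  define A where "A = (\<Union>b<k. block b) \<union> U"
  have "0 \<notin> e ` {..<CARD('n)}"
  proof
    assume "0 \<in> e ` {..<CARD('n)}"
    then obtain j where j: "j < CARD('n)" "e j = 0"
      by auto
    obtain t where "g t = j"
      using obtain_coordinate[OF j(1)] .
    then have "e j $ t = 1"
      by (simp add: e_nth)
    with j show False
      by simp
  qed
  then have "0 \<notin> U"
    by (auto simp: U_def)
  moreover have "0 \<notin> block b" if "b < k" for b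
  proof (rule zero_notin_block)
    have "Suc b * Suc \<rho> \<le> k * Suc \<rho>"
      using that by (simp only: mult_le_mono1 Suc_leI)
    then show "Suc b * Suc \<rho> \<le> CARD('n)"
      using k by linarith
  qed
  ultimately have "0 \<notin> A"
    by (auto simp: A_def)
  moreover have "spans_with (Suc \<rho>) A"
    unfolding A_def by (rule blocks_spans_with) (use k in \<open>auto simp: U_def\<close>)
  moreover have "\<rho> < CARD('n)"
    using k by (cases k) auto
  ultimately have "min_saturating_size TYPE('a) TYPE('n) \<rho> \<le> card A"
    using min_saturating_size_le by blast
  also have "\<dots> \<le> card (\<Union>b<k. block b) + card U"
    unfolding A_def by (rule card_Un_le)
  also have "card (\<Union>b<k. block b) \<le>
      (\<Sum>b<k. \<Sum>i<Suc \<rho>. 1 + Suc i * (Q ^ (CARD('n) - Suc b * Suc \<rho>) - 1))"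
    using card_block_le unfolding card_F
    by (intro order.trans[OF card_UN_le sum_mono]) auto
  also have "card U \<le> (if CARD('n) = Suc k * Suc \<rho> then Suc \<rho> else 0)"
    using card_image_le[of "{k * Suc \<rho>..<CARD('n)}" e] by (auto simp: U_def)
  finally show ?thesis
    by simp
qed

section \<open>Comparison with the bound\<close>

text \<open>A common form of \<open>a_tilde\<close> and \<open>a_bar\<close>, so that both families
  of lower-order terms obey the same estimates.\<close>

definition weight :: "nat \<Rightarrow> nat \<Rightarrow> nat \<Rightarrow> real" where
  "weight l \<rho> j = (real l * (2 * real \<rho> - real l + 2 * real j + 1) - real j * (3 * real j + 1)) / 2"

lemma a_tilde_eq_weight: "a_tilde \<rho> j = weight \<rho> \<rho> j"
  by (simp add: a_tilde_def weight_def)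

lemma a_bar_eq_weight: "a_bar N \<rho> j = weight (sat_l N \<rho>) \<rho> j"
  by (simp add: a_bar_def weight_def Let_def)

text \<open>Twice the difference of the two sides is the sum of the two products in the proof, both
  nonnegative.\<close>

lemma weight_ge:
  assumes "j < l" and "l \<le> Suc \<rho>"
  shows "real j \<le> weight l \<rho> j"
proof -
  have "0 \<le> (real l - real j - 1) * (real l + 3 * real j)"
    using assms by simp
  moreover have "0 \<le> real l * (2 * real \<rho> - 2 * real l + 2)"
    using assms by simp
  ultimately show ?thesis
    unfolding weight_def by (simp add: algebra_simps)
qed

text \<open>The value is the \<open>l\<close>-dependent part of \<open>c_bar\<close>: with all
  powers replaced by 1, the lower-order terms exactly offset this constant.\<close>

lemma sum_weight:
  assumes "0 < l"
  shows "(\<Sum>j = 1..l - 1. weight l \<rho> j) = real l * (real l - 1) * (2 * real \<rho> - real l + 1) / 2"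
proof -
  have "(\<Sum>j = 1..n. weight l \<rho> j) = real n * (real l * (2 * real \<rho> - real l + 1)
      + (real n + 1) * (real l - real n - 1)) / 2" for n
    by (induction n) (simp_all add: weight_def field_simps)
  from this[of "l - 1"] show ?thesis
    using assms by (simp add: of_nat_diff)
qed

lemma sum_weight_le:
  assumes "0 < l" "l \<le> Suc \<rho>" and X: "\<And>j. \<lbrakk>1 \<le> j; j < l\<rbrakk> \<Longrightarrow> 1 \<le> X j"
  shows "real l * (real l - 1) * (2 * real \<rho> - real l + 1) / 2 \<le> (\<Sum>j = 1..l - 1. weight l \<rho> j * X j)"
proof -
  have "weight l \<rho> j * 1 \<le> weight l \<rho> j * X j" if j: "j \<in> {1..l - 1}" for j
  proof (rule mult_left_mono)
    show "1 \<le> X j"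
      using j assms(1) by (intro X) auto
    show "0 \<le> weight l \<rho> j"
      using j assms(1,2) weight_ge[of j l \<rho>] by fastforce
  qed
  then have "(\<Sum>j = 1..l - 1. weight l \<rho> j) \<le> (\<Sum>j = 1..l - 1. weight l \<rho> j * X j)"
    by (intro sum_mono) simp
  then show ?thesis
    unfolding sum_weight[OF assms(1)] .
qed

text \<open>The power at \<open>j = \<rho>\<close> is \<open>Q\<close>, and its weight is at least
  \<rho>. The surplus is kept to pay for the added unit vectors.\<close>

lemma sum_weight_power_full_block:
  assumes "0 < \<rho>" "2 \<le> Q"
  defines "l \<equiv> Suc \<rho>"
  shows "real l * (real l - 1) * (2 * real \<rho> - real l + 1) / 2 + real \<rho> * (real Q - 1)
    \<le> (\<Sum>j = 1..l - 1. weight l \<rho> j * real Q ^ (l - j))"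
proof -
  \<comment> \<open>At \<open>j = \<rho>\<close> only 1 is retained from the power \<open>Q\<close>;
    \<open>Q - 1\<close> is set aside.\<close>
  define X where "X j = real Q ^ (l - j) - (if j = \<rho> then real Q - 1 else 0)" for j
  have "real l * (real l - 1) * (2 * real \<rho> - real l + 1) / 2 \<le> (\<Sum>j = 1..l - 1. weight l \<rho> j * X j)"
  proof (rule sum_weight_le)
    show "1 \<le> X j" if "1 \<le> j" "j < l" for j
      using that assms one_le_power[of "real Q" "l - j"] by (cases "j = \<rho>") (auto simp: X_def)
  qed (simp_all add: l_def)
  also have "\<dots> = (\<Sum>j = 1..l - 1. weight l \<rho> j * real Q ^ (l - j))
      - (\<Sum>j = 1..l - 1. if j = \<rho> then weight l \<rho> \<rho> * (real Q - 1) else 0)"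
    unfolding sum_subtractf[symmetric] by (rule sum.cong) (auto simp: X_def algebra_simps)
  also have "(\<Sum>j = 1..l - 1. if j = \<rho> then weight l \<rho> \<rho> * (real Q - 1) else 0)
      = weight l \<rho> \<rho> * (real Q - 1)"
    using assms by (simp add: l_def)
  finally have "real l * (real l - 1) * (2 * real \<rho> - real l + 1) / 2 + weight l \<rho> \<rho> * (real Q - 1)
      \<le> (\<Sum>j = 1..l - 1. weight l \<rho> j * real Q ^ (l - j))"
    by simp
  moreover have "real \<rho> * (real Q - 1) \<le> weight l \<rho> \<rho> * (real Q - 1)"
    using assms weight_ge[of \<rho> l \<rho>] by (intro mult_right_mono) auto
  ultimately show ?thesis
    by linarith
qed

lemma sum_block_sizes:
  assumes "1 \<le> X"
  shows "real (\<Sum>i<Suc \<rho>. 1 + Suc i * (X - 1)) =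
    (real \<rho> + 1) * (real \<rho> + 2) / 2 * real X - real \<rho> * (real \<rho> + 1) / 2"
  using assms by (induction \<rho>) (simp_all add: of_nat_diff field_simps)

theorem theorem7p12:
  fixes N \<rho> q' :: nat
  assumes "0 < \<rho>" and "\<rho> < N"
    and "primepow q'"
    and "CARD('a::{field,finite}) = q' ^ (\<rho> + 1)"
    and "CARD('n::finite) = N + 1"
  shows "real (min_saturating_size TYPE('a) TYPE('n) \<rho>) \<le>
      (\<Sum>i = 1..sat_k N \<rho>.
         (real \<rho> + 1) * (real \<rho> + 2) / 2 * real q' ^ (N + 1 - i * (\<rho> + 1)))
    + (\<Sum>i = 1..sat_k N \<rho> - 1. \<Sum>j = 1..\<rho> - 1.
         a_tilde \<rho> j * real q' ^ (N + 1 - i * (\<rho> + 1) - j))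
    + (\<Sum>j = 1..sat_l N \<rho> - 1. a_bar N \<rho> j * real q' ^ (sat_l N \<rho> - j))
    - c_tilde N \<rho> - c_bar N \<rho>
    + of_bool (q' = 2) *
        ((2 ^ (\<rho> - 1) - 1) * (\<Sum>i = 1..sat_k N \<rho> - 1. 2 ^ (N - \<rho> + 2 - i * (\<rho> + 1)))
         + 2 ^ sat_l N \<rho> - 2)"
proof -
  define k where "k = sat_k N \<rho>"
  define l where "l = sat_l N \<rho>"
  have q': "2 \<le> q'"
    using primepow_gt_Suc_0[OF assms(3)] by simp
  have k_div: "k = N div Suc \<rho>" and l_mod: "l = Suc (N mod Suc \<rho>)"
    using sat_k_eq_div[OF assms(2)] sat_l_eq_mod[OF assms(2)] by (simp_all add: k_def l_def)
  have "0 < k"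
    using assms(2) by (simp add: k_div div_greater_zero_iff)
  have N: "N + 1 = k * Suc \<rho> + l"
    unfolding k_div l_mod by (metis add.commute add_Suc_right div_mult_mod_eq plus_1_eq_Suc)
  have l: "0 < l" "l \<le> Suc \<rho>"
    using mod_less_divisor[of "Suc \<rho>" N] unfolding l_mod by linarith+
  define extra :: nat where "extra = (if l = Suc \<rho> then Suc \<rho> else 0)"

  define size where "size b = (\<Sum>i<Suc \<rho>. 1 + Suc i * (q' ^ (N + 1 - Suc b * Suc \<rho>) - 1))" for b
  have "min_saturating_size TYPE('a) TYPE('n) \<rho> \<le>
      (\<Sum>b<k. size b) + (if CARD('n) = Suc k * Suc \<rho> then Suc \<rho> else 0)"
    unfolding size_def assms(5)[symmetric]
    by (rule min_saturating_size_le_blocks) (use assms(3-5) \<open>0 < k\<close> N l in auto)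
  also have "(if CARD('n) = Suc k * Suc \<rho> then Suc \<rho> else 0) = extra"
    using N assms(5) by (simp add: extra_def)
  finally have "real (min_saturating_size TYPE('a) TYPE('n) \<rho>) \<le> real ((\<Sum>b<k. size b) + extra)"
    by (rule of_nat_mono)
  also have "\<dots> = (\<Sum>b<k. real (size b)) + real extra"
    by simp
  also have "\<dots> = (\<Sum>b<k. (real \<rho> + 1) * (real \<rho> + 2) / 2 * real q' ^ (N + 1 - Suc b * Suc \<rho>)
      - real \<rho> * (real \<rho> + 1) / 2) + real extra"
    unfolding size_def using q' by (subst sum_block_sizes) (simp_all add: Suc_le_eq)
  also have "\<dots> = (\<Sum>i = 1..k. (real \<rho> + 1) * (real \<rho> + 2) / 2 * real q' ^ (N + 1 - i * (\<rho> + 1)))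
      - real k * (real \<rho> * (real \<rho> + 1) / 2) + real extra"
    by (simp add: sum_subtractf sum.atLeast1_atMost_eq)
  finally have main: "real (min_saturating_size TYPE('a) TYPE('n) \<rho>) \<le>
      (\<Sum>i = 1..k. (real \<rho> + 1) * (real \<rho> + 2) / 2 * real q' ^ (N + 1 - i * (\<rho> + 1)))
      - real k * (real \<rho> * (real \<rho> + 1) / 2) + real extra" .

  \<comment> \<open>The power is at least 1 even where the subtraction in the exponent truncates, so
    this holds for every \<open>i\<close>.\<close>
  have "real \<rho> * (real \<rho> - 1) * (2 * real \<rho> - real \<rho> + 1) / 2 \<le>
      (\<Sum>j = 1..\<rho> - 1. weight \<rho> \<rho> j * real q' ^ (N + 1 - i * (\<rho> + 1) - j))" for i
    using assms(1) q' by (intro sum_weight_le) (auto intro: one_le_power)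
  then have "(\<Sum>i = 1..k - 1. real \<rho> * (real \<rho> - 1) * (2 * real \<rho> - real \<rho> + 1) / 2) \<le>
      (\<Sum>i = 1..k - 1. \<Sum>j = 1..\<rho> - 1. weight \<rho> \<rho> j * real q' ^ (N + 1 - i * (\<rho> + 1) - j))"
    by (intro sum_mono)
  then have tilde: "(real k - 1) * (real \<rho> * (real \<rho> - 1) * (real \<rho> + 1) / 2) \<le>
      (\<Sum>i = 1..k - 1. \<Sum>j = 1..\<rho> - 1. a_tilde \<rho> j * real q' ^ (N + 1 - i * (\<rho> + 1) - j))"
    using \<open>0 < k\<close> by (simp add: a_tilde_eq_weight of_nat_diff)

  define base where "base = real l * (real l - 1) * (2 * real \<rho> - real l + 1) / 2"
  define corr :: real where "corr = of_bool (q' = 2) * (2 ^ l - 2)"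
  have "(2 :: real) ^ 1 \<le> 2 ^ l"
    using l by (intro power_increasing) auto
  then have "0 \<le> corr"
    by (simp add: corr_def)
  have bar: "base + real extra \<le> (\<Sum>j = 1..l - 1. a_bar N \<rho> j * real q' ^ (l - j)) + corr"
  proof (cases "l = Suc \<rho>")
    case True
    \<comment> \<open>For \<open>q' \<ge> 3\<close>, \<open>\<rho> * (q' - 1)\<close> is at least
      \<open>2 * \<rho>\<close> and pays for the \<open>Suc \<rho>\<close> unit vectors. For
      \<open>q' = 2\<close> it falls one short, and \<open>2 ^ l - 2 \<ge> 2\<close> makes up for
      it.\<close>
    have "real extra \<le> real \<rho> * (real q' - 1) + corr"
    proof (cases "q' = 2")
      case True
      have "(2 :: real) ^ 2 \<le> 2 ^ l"
        using \<open>l = Suc \<rho>\<close> assms(1) by (intro power_increasing) auto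
      then show ?thesis
        using True \<open>l = Suc \<rho>\<close> by (simp add: corr_def extra_def)
    next
      case False
      then have "real \<rho> * 2 \<le> real \<rho> * (real q' - 1)"
        using q' by (intro mult_left_mono) auto
      moreover have "real extra \<le> real \<rho> * 2"
        using assms(1) by (simp add: extra_def)
      ultimately show ?thesis
        using \<open>0 \<le> corr\<close> by linarith
    qed
    then show ?thesis
      using sum_weight_power_full_block[OF assms(1) q'] True
      by (simp only: base_def a_bar_eq_weight l_def[symmetric])
  next
    case False
    have "base \<le> (\<Sum>j = 1..l - 1. weight l \<rho> j * real q' ^ (l - j))"
      unfolding base_def using l q' by (intro sum_weight_le) (auto intro: one_le_power)
    then show ?thesis
      using False \<open>0 \<le> corr\<close> by (simp add: extra_def a_bar_eq_weight l_def[symmetric])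
  qed

  have "0 \<le> of_bool (q' = 2) *
      ((2 ^ (\<rho> - 1) - 1) * (\<Sum>i = 1..k - 1. 2 ^ (N - \<rho> + 2 - i * (\<rho> + 1)) :: real))"
    by (intro mult_nonneg_nonneg sum_nonneg) auto
  then have delta: "corr \<le> of_bool (q' = 2) *
      ((2 ^ (\<rho> - 1) - 1) * (\<Sum>i = 1..k - 1. 2 ^ (N - \<rho> + 2 - i * (\<rho> + 1))) + 2 ^ l - 2)"
    by (simp add: corr_def algebra_simps)
  \<comment> \<open>Splitting the square of \<rho> as \<open>\<rho> + \<rho> * (\<rho> - 1)\<close>
    separates the constant of each block size from the amounts bounded in \<open>tilde\<close> and
    \<open>bar\<close>.\<close>
  have constants: "c_tilde N \<rho> + c_bar N \<rho> =
      real k * (real \<rho> * (real \<rho> + 1) / 2) + (real k - 1) * (real \<rho> * (real \<rho> - 1) * (real \<rho> + 1) / 2) + base"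
    by (simp add: c_tilde_def c_bar_def k_def[symmetric] l_def[symmetric] base_def Let_def
        power2_eq_square field_simps)
  show ?thesis
    using main tilde bar delta constants unfolding k_def l_def by linarith
qed

end
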